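(* Let $n,m$ be positive integers and let $\{a_x\}_{x=0}^\infty$ be the $(n,m)$-bin sequence. Let the random variable $Y_k$ denote the number of summands in the (unique) $(n,m)$-bin legal decomposition of an integer chosen uniformly at random from $[0,a_{(n+m)k})$. Let $\mu_k$ and $\sigma_k^2$ denote the mean and variance of $Y_k$ respectively, and let $Y_k'=(Y_k-\mu_k)/\sigma_k$. Then, as $k\to\infty$, $$\mu_k=Ck+O(1),\qquad \sigma_k^2=C'k+O(1),$$ where $C$ and $C'$ are the positive constants $$C=\frac{\sqrt{(1+m+n)^2-4mn}-1}{\sqrt{(1+m+n)^2-4mn}},\qquad C'=\frac{(m+n)(1+m+n)-4mn}{\left(\sqrt{(1+m+n)^2-4mn}\right)^3}.$$ Moreover, $Y_k'$ converges in distribution to the standard normal distribution as $k\to\infty$.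
   Context: Fix positive integers $n,m$. The terms $a_0<a_1<a_2<\cdots$ of an increasing sequence of positive integers are divided, in order, into consecutive bins whose sizes alternate $n,m,n,m,\ldots$: the first bin is $\{a_0,\ldots,a_{n-1}\}$, the second is $\{a_n,\ldots,a_{n+m-1}\}$, the third is $\{a_{n+m},\ldots,a_{n+m+n-1}\}$, and so on. Two bins are adjacent if they are consecutive in this ordering. An $(n,m)$-bin legal decomposition of an integer is an expression of it as a sum of terms of the sequence in which no two summands are from the same bin or from adjacent bins; the integer $0$ has the empty decomposition, with $0$ summands. The $(n,m)$-bin sequence is the unique increasing sequence of positive integers $\{a_x\}_{x=0}^\infty$ such that every positive integer has a unique $(n,m)$-bin legal decomposition. The implied constants in $O(1)$ may depend on $n,m$ but not on $k$. *)

theory Defs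
  imports "HOL-Probability.Probability" "HOL-Library.Landau_Symbols"
begin

text \<open>
  Bins are numbered from 0. Each block of \<open>n + m\<close> consecutive indices consists of a bin of
  size \<open>n\<close> (an even-numbered bin) followed by a bin of size \<open>m\<close> (an odd-numbered bin).
\<close>

definition bin_index :: "nat \<Rightarrow> nat \<Rightarrow> nat \<Rightarrow> nat" where
  "bin_index n m x = 2 * (x div (n + m)) + (if x mod (n + m) < n then 0 else 1)"

definition adjacent_bins :: "nat \<Rightarrow> nat \<Rightarrow> bool" where
  "adjacent_bins b c \<longleftrightarrow> b = Suc c \<or> c = Suc b"

text \<open>
  A decomposition is represented by the set of indices of its summands. Using a set loses
  nothing: a term used twice would give two summands from the same bin.
\<close>

definition legal_decomposition ::
    "nat \<Rightarrow> nat \<Rightarrow> (nat \<Rightarrow> nat) \<Rightarrow> nat \<Rightarrow> nat set \<Rightarrow> bool" where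
  "legal_decomposition n m a N S \<longleftrightarrow>
     finite S \<and> N = (\<Sum>x\<in>S. a x) \<and>
     (\<forall>x\<in>S. \<forall>y\<in>S. x \<noteq> y \<longrightarrow>
        bin_index n m x \<noteq> bin_index n m y \<and>
        \<not> adjacent_bins (bin_index n m x) (bin_index n m y))"

definition is_bin_sequence :: "nat \<Rightarrow> nat \<Rightarrow> (nat \<Rightarrow> nat) \<Rightarrow> bool" where
  "is_bin_sequence n m a \<longleftrightarrow>
     strict_mono a \<and> (\<forall>x. 0 < a x) \<and>
     (\<forall>N>0. \<exists>!S. legal_decomposition n m a N S)"

definition num_summands :: "nat \<Rightarrow> nat \<Rightarrow> (nat \<Rightarrow> nat) \<Rightarrow> nat \<Rightarrow> nat" where
  "num_summands n m a N = card (THE S. legal_decomposition n m a N S)"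

text \<open>
  The same function \<open>Y n m a\<close> represents every \<open>Y\<^sub>k\<close>; the dependence on \<open>k\<close> lies in the
  probability space \<open>uniform_below n m a k\<close>.
\<close>

definition uniform_below :: "nat \<Rightarrow> nat \<Rightarrow> (nat \<Rightarrow> nat) \<Rightarrow> nat \<Rightarrow> nat pmf" where
  "uniform_below n m a k = pmf_of_set {0..<a ((n + m) * k)}"

definition Y :: "nat \<Rightarrow> nat \<Rightarrow> (nat \<Rightarrow> nat) \<Rightarrow> nat \<Rightarrow> real" where
  "Y n m a N = real (num_summands n m a N)"

definition mean_Y :: "nat \<Rightarrow> nat \<Rightarrow> (nat \<Rightarrow> nat) \<Rightarrow> nat \<Rightarrow> real" where
  "mean_Y n m a k = measure_pmf.expectation (uniform_below n m a k) (Y n m a)"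

definition var_Y :: "nat \<Rightarrow> nat \<Rightarrow> (nat \<Rightarrow> nat) \<Rightarrow> nat \<Rightarrow> real" where
  "var_Y n m a k = measure_pmf.variance (uniform_below n m a k) (Y n m a)"

definition normalized_Y :: "nat \<Rightarrow> nat \<Rightarrow> (nat \<Rightarrow> nat) \<Rightarrow> nat \<Rightarrow> nat \<Rightarrow> real" where
  "normalized_Y n m a k N = (Y n m a N - mean_Y n m a k) / sqrt (var_Y n m a k)"

definition mean_const :: "nat \<Rightarrow> nat \<Rightarrow> real" where
  "mean_const n m =
     (sqrt ((1 + real m + real n)\<^sup>2 - 4 * real m * real n) - 1) /
     sqrt ((1 + real m + real n)\<^sup>2 - 4 * real m * real n)"

definition var_const :: "nat \<Rightarrow> nat \<Rightarrow> real" where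
  "var_const n m =
     ((real m + real n) * (1 + real m + real n) - 4 * real m * real n) /
     (sqrt ((1 + real m + real n)\<^sup>2 - 4 * real m * real n)) ^ 3"

end

theory Submission
  imports Defs "HOL-Computational_Algebra.Polynomial"
begin

text \<open>
  A sum of a legal set of terms with indices below \<open>x\<close> is smaller than \<open>a x\<close>, so \<open>a (x + 1)\<close>
  is \<open>a x\<close> plus the first term of the preceding bin, and over full blocks the generating
  function \<open>F\<^sub>k(z)\<close> of the number of summands satisfies
  \<open>F\<^bsub>k+2\<^esub> = (1 + (n + m) z) F\<^bsub>k+1\<^esub> - n m z\<^sup>2 F\<^sub>k\<close>. This is a rescaled Chebyshev recurrence of the
  second kind, so \<open>F\<^sub>k(z)\<close> is the product over \<open>j = 1, ..., k\<close> of the factors \<open>1 + c\<^sub>j z\<close> with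
  \<open>c\<^sub>j = n + m - 2 sqrt (n m) cos (j pi / (k + 1)) \<ge> 0\<close>. Hence \<open>Y\<^sub>k\<close> is distributed as a sum of \<open>k\<close>
  independent Bernoulli variables, and Levy's continuity theorem gives the normal limit once the
  variance is known to grow linearly. Mean and variance are the first two derivatives at \<open>0\<close> of
  \<open>t \<mapsto> ln F\<^sub>k(exp t)\<close>, computed from the closed form of \<open>F\<^sub>k\<close> in terms of the roots of the
  characteristic equation.
\<close>

section \<open>The recurrence of the generating function\<close>

locale bin_sequence =
  fixes n m :: nat and a :: "nat \<Rightarrow> nat"
  assumes n_pos: "0 < n" and m_pos: "0 < m" and bin_seq: "is_bin_sequence n m a"
begin

abbreviation legal :: "nat \<Rightarrow> nat set \<Rightarrow> bool" where
  "legal \<equiv> legal_decomposition n m a"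

section \<open>Existence and uniqueness of legal decompositions\<close>

lemma strict_mono_a: "strict_mono a" and a_pos: "0 < a x"
  using bin_seq by (auto simp: is_bin_sequence_def)

lemma legal_member_le:
  assumes "legal N S" "x \<in> S"
  shows "a x \<le> N"
  using assms by (auto simp: legal_decomposition_def intro: member_le_sum)

lemma legal_subset_lessThan:
  assumes "legal N S" "N < a x"
  shows "S \<subseteq> {..<x}"
proof
  fix y assume "y \<in> S"
  then have "a y < a x"
    using legal_member_le[OF assms(1)] assms(2) by fastforce
  then show "y \<in> {..<x}"
    using strict_mono_a by (simp add: strict_mono_less)
qed

lemma legal_0_iff: "legal 0 S \<longleftrightarrow> S = {}"
proof
  assume "legal 0 S"
  then show "S = {}" using legal_subset_lessThan[of 0 S 0] a_pos[of 0] by simp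
qed (simp add: legal_decomposition_def)

text \<open>The axioms of a bin sequence speak of positive integers only. For 0, positivity of the
  terms forces the empty set.\<close>

lemma ex1_legal: "\<exists>!S. legal N S"
proof (cases "N = 0")
  case True
  then show ?thesis by (simp add: legal_0_iff)
next
  case False
  then show ?thesis using bin_seq by (auto simp: is_bin_sequence_def)
qed

lemma legal_unique: "legal N S \<Longrightarrow> legal N T \<Longrightarrow> S = T"
  using ex1_legal by blast

lemma num_summands_eq: "legal N S \<Longrightarrow> num_summands n m a N = card S"
  unfolding num_summands_def using legal_unique by (metis the_equality)

section \<open>Indices compatible with a given largest index\<close>

definition prev_bin_start :: "nat \<Rightarrow> nat" where
  "prev_bin_start x =
     (if x mod (n + m) < n
      then if x div (n + m) = 0 then 0 else (n + m) * (x div (n + m) - 1) + n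
      else (n + m) * (x div (n + m)))"

text \<open>This turns non-adjacency into an inequality between indices: the smaller indices that
  may accompany \<open>x\<close> form an initial segment. For \<open>x\<close> in bin 0 the bound is
  0, so this segment is empty.\<close>

lemma less_prev_bin_start_iff:
  "y < prev_bin_start x \<longleftrightarrow> Suc (bin_index n m y) < bin_index n m x"
proof -
  define K where "K = n + m"
  define q r where "q = y div K" and "r = y mod K"
  have K: "0 < K" "n < K" using n_pos m_pos by (auto simp: K_def)
  have y: "y = K * q + r" "r < K" using K by (auto simp: q_def r_def)
  have less: "K * q + r < K * u \<longleftrightarrow> q < u" for u
  proof
    assume "K * q + r < K * u"
    then show "q < u" by (meson add_lessD1 nat_mult_less_cancel1 K(1))
  next
    assume "q < u"
    then have "K * Suc q \<le> K * u" by (intro mult_le_mono) auto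
    then show "K * q + r < K * u" using y(2) by simp
  qed
  have less_n: "K * q + r < K * u + n \<longleftrightarrow> q < u \<or> (q = u \<and> r < n)" for u
  proof -
    consider "q < u" | "q = u" | "u < q" by linarith
    then show ?thesis
    proof cases
      case 1
      then show ?thesis using less[of u] by simp
    next
      case 3
      then have "K * Suc u \<le> K * q" by (intro mult_le_mono) auto
      then show ?thesis using 3 K by simp
    qed simp
  qed
  have bin_y: "bin_index n m y = 2 * q + (if r < n then 0 else 1)"
    by (simp add: bin_index_def q_def r_def K_def)
  define u v where "u = x div K" and "v = x mod K"
  have bin_x: "bin_index n m x = 2 * u + (if v < n then 0 else 1)"
    by (simp add: bin_index_def u_def v_def K_def)
  have start_x: "prev_bin_start x = (if v < n then if u = 0 then 0 else K * (u - 1) + n else K * u)"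
    by (simp add: prev_bin_start_def u_def v_def K_def)
  show ?thesis
  proof (cases "v < n")
    case True
    then show ?thesis
      unfolding bin_x bin_y start_x using less_n[of "u - 1"] y(1)
      by (cases "u = 0") (simp, simp, linarith)
  next
    case False
    then show ?thesis
      unfolding bin_x bin_y start_x using less[of u] y(1) by simp linarith
  qed
qed

lemma bin_index_mono: "y \<le> x \<Longrightarrow> bin_index n m y \<le> bin_index n m x"
proof -
  assume "y \<le> x"
  then have "y div (n + m) \<le> x div (n + m)" by (rule div_le_mono)
  moreover have "x mod (n + m) < n \<longrightarrow> y mod (n + m) < n" if "y div (n + m) = x div (n + m)"
    using that \<open>y \<le> x\<close>
    by (metis add_le_cancel_left le_less_trans mult_div_mod_eq)
  ultimately show ?thesis
    by (cases "y div (n + m) = x div (n + m)") (auto simp: bin_index_def)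
qed

lemma prev_bin_start_le: "prev_bin_start x \<le> x"
  using less_prev_bin_start_iff[of x x] by (meson not_le not_less_iff_gr_or_eq lessI less_trans)

text \<open>Together with \<open>legal_remove\<close> this matches the legal sets with largest index
  \<open>x\<close> with the legal sets below \<open>prev_bin_start x\<close>.\<close>

lemma legal_insert:
  assumes "legal N S" "S \<subseteq> {..<prev_bin_start x}"
  shows "legal (a x + N) (insert x S)" "x \<notin> S"
proof -
  show "x \<notin> S" using assms(2) prev_bin_start_le[of x] by auto
  have far: "Suc (bin_index n m y) < bin_index n m x" if "y \<in> S" for y
    using that assms(2) less_prev_bin_start_iff by auto
  show "legal (a x + N) (insert x S)"
    using assms(1) \<open>x \<notin> S\<close>
    by (auto simp: legal_decomposition_def adjacent_bins_def dest!: far)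
qed

lemma legal_remove:
  assumes "legal N S" "S \<subseteq> {..<Suc x}" "x \<in> S"
  shows "legal (N - a x) (S - {x})" "S - {x} \<subseteq> {..<prev_bin_start x}"
proof -
  show "legal (N - a x) (S - {x})"
    using assms by (auto simp: legal_decomposition_def sum.remove)
  show "S - {x} \<subseteq> {..<prev_bin_start x}"
  proof
    fix y assume y: "y \<in> S - {x}"
    then have "bin_index n m y \<noteq> bin_index n m x" "bin_index n m x \<noteq> Suc (bin_index n m y)"
      using assms by (auto simp: legal_decomposition_def adjacent_bins_def)
    moreover have "bin_index n m y \<le> bin_index n m x"
      using y assms(2) by (intro bin_index_mono) auto
    ultimately show "y \<in> {..<prev_bin_start x}"
      by (simp add: less_prev_bin_start_iff)
  qed
qed

section \<open>The recursion for the terms of the sequence\<close>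

lemma legal_singleton: "legal (a x) {x}"
  by (simp add: legal_decomposition_def)

text \<open>If the gap were smaller, the decomposition of \<open>a (Suc x) - a x\<close> would stay
  below the preceding bin. Adding \<open>x\<close> to it would then give \<open>a (Suc x)\<close> a
  second decomposition besides \<open>{Suc x}\<close>.\<close>

lemma a_Suc_ge: "a x + a (prev_bin_start x) \<le> a (Suc x)"
proof (rule ccontr)
  assume "\<not> ?thesis"
  then have lt: "a (Suc x) - a x < a (prev_bin_start x)"
    using a_pos[of "prev_bin_start x"] by linarith
  have less: "a x < a (Suc x)" using strict_mono_a by (simp add: strict_mono_less)
  obtain S where S: "legal (a (Suc x) - a x) S" using ex1_legal by blast
  have sub: "S \<subseteq> {..<prev_bin_start x}" by (rule legal_subset_lessThan[OF S lt])
  have "legal (a (Suc x)) (insert x S)" using legal_insert(1)[OF S sub] less by simp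
  then have "insert x S = {Suc x}" using legal_singleton legal_unique by blast
  then show False by auto
qed

text \<open>Strong induction on the bound. If the top index \<open>u\<close> is used, the rest lies
  below \<open>prev_bin_start u\<close>, so its sum is less than \<open>a (prev_bin_start u)\<close>
  and \<open>a_Suc_ge\<close> absorbs both parts.\<close>

lemma legal_sum_less: "legal N S \<Longrightarrow> S \<subseteq> {..<x} \<Longrightarrow> N < a x"
proof (induction x arbitrary: N S rule: less_induct)
  case (less x)
  show ?case
  proof (cases x)
    case 0
    then show ?thesis using less.prems a_pos by (auto simp: legal_decomposition_def)
  next
    case (Suc u)
    show ?thesis
    proof (cases "u \<in> S")
      case False
      then have "S \<subseteq> {..<u}" using less.prems(2) Suc by (auto simp: less_Suc_eq)
      then have "N < a u" using less.IH[of u] less.prems(1) Suc by auto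
      then show ?thesis using strict_mono_a Suc by (simp add: strict_mono_less less_trans)
    next
      case True
      note removed = legal_remove[OF less.prems(1) less.prems(2)[unfolded Suc] True]
      have "N - a u < a (prev_bin_start u)"
        using less.IH[OF _ removed] prev_bin_start_le[of u] Suc by simp
      then show ?thesis using a_Suc_ge[of u] Suc by simp
    qed
  qed
qed

lemma a_0: "a 0 = 1"
proof (rule ccontr)
  assume "a 0 \<noteq> 1"
  then have "1 < a 0" using a_pos[of 0] by simp
  obtain S where S: "legal 1 S" using ex1_legal by blast
  then have "S = {}" using legal_subset_lessThan[OF S \<open>1 < a 0\<close>] by simp
  then show False using S by (simp add: legal_decomposition_def)
qed

text \<open>If \<open>a (Suc x)\<close> were larger, \<open>N = a x + a (prev_bin_start x)\<close>
  would need a decomposition with indices at most \<open>x\<close>. By \<open>legal_sum_less\<close>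
  every such sum is below \<open>N\<close>, whether or not \<open>x\<close> is used.\<close>

lemma a_Suc: "a (Suc x) = a x + a (prev_bin_start x)"
proof (rule ccontr)
  define N where "N = a x + a (prev_bin_start x)"
  assume "\<not> ?thesis"
  then have lt: "N < a (Suc x)" using a_Suc_ge[of x] by (simp add: N_def)
  obtain S where S: "legal N S" using ex1_legal by blast
  have sub: "S \<subseteq> {..<Suc x}" by (rule legal_subset_lessThan[OF S lt])
  show False
  proof (cases "x \<in> S")
    case True
    show False
      using legal_sum_less[OF legal_remove[OF S sub True]] by (simp add: N_def)
  next
    case False
    then have "S \<subseteq> {..<x}" using sub by (auto simp: less_Suc_eq)
    then have "N < a x" by (rule legal_sum_less[OF S])
    then show False by (simp add: N_def)
  qed
qed

section \<open>The generating function of the number of summands\<close>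

lemma num_summands_add:
  assumes "N < a (prev_bin_start x)"
  shows "num_summands n m a (a x + N) = Suc (num_summands n m a N)"
proof -
  obtain S where S: "legal N S" using ex1_legal by blast
  have sub: "S \<subseteq> {..<prev_bin_start x}" by (rule legal_subset_lessThan[OF S assms])
  have "finite S" using S by (simp add: legal_decomposition_def)
  then show ?thesis
    using num_summands_eq[OF S] num_summands_eq[OF legal_insert(1)[OF S sub]] legal_insert(2)[OF S sub]
    by simp
qed

text \<open>The ring stays general because the function is evaluated at the real
  \<open>exp t\<close> for the moments and at the complex \<open>iexp t\<close> for the
  characteristic function.\<close>

definition summand_gf :: "nat \<Rightarrow> 'b::comm_ring_1 \<Rightarrow> 'b" where
  "summand_gf x z = (\<Sum>N<a x. z ^ num_summands n m a N)"

lemma summand_gf_0: "summand_gf 0 z = 1"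
  using num_summands_eq[of 0 "{}"] legal_0_iff by (simp add: summand_gf_def a_0)

text \<open>Split the range at \<open>a x\<close>. An integer in the upper part is
  \<open>a x + N\<close> with \<open>N < a (prev_bin_start x)\<close> and has one summand more than
  \<open>N\<close>.\<close>

lemma summand_gf_Suc:
  "summand_gf (Suc x) z = summand_gf x z + z * summand_gf (prev_bin_start x) z"
proof -
  have "{..<a (Suc x)} = {..<a x} \<union> {a x..<a x + a (prev_bin_start x)}"
    by (auto simp: a_Suc)
  then have "summand_gf (Suc x) z = summand_gf x z +
      (\<Sum>N=a x..<a x + a (prev_bin_start x). z ^ num_summands n m a N)"
    unfolding summand_gf_def by (simp add: sum.union_disjoint ivl_disj_int)
  also have "(\<Sum>N=a x..<a x + a (prev_bin_start x). z ^ num_summands n m a N) =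
      (\<Sum>N<a (prev_bin_start x). z ^ num_summands n m a (a x + N))"
    by (rule sum.reindex_bij_witness[of _ "\<lambda>N. a x + N" "\<lambda>N. N - a x"]) auto
  also have "\<dots> = z * summand_gf (prev_bin_start x) z"
    by (simp add: num_summands_add summand_gf_def sum_distrib_left)
  finally show ?thesis .
qed

text \<open>Within one bin \<open>prev_bin_start\<close> is constant, so each term of the bin
  contributes the same increment.\<close>

lemma summand_gf_add_const:
  assumes "\<And>i. i < j \<Longrightarrow> prev_bin_start (x + i) = s"
  shows "summand_gf (x + j) z = summand_gf x z + of_nat j * z * summand_gf s z"
  using assms
proof (induction j)
  case (Suc j)
  then show ?case by (simp add: summand_gf_Suc algebra_simps)
qed simp

lemma prev_bin_start_even_0: "i < n \<Longrightarrow> prev_bin_start i = 0"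
  by (simp add: prev_bin_start_def)

lemma block_div_mod:
  assumes "i < n + m"
  shows "((n + m) * k + i) div (n + m) = k" "((n + m) * k + i) mod (n + m) = i"
proof -
  have "n + m \<noteq> 0" using n_pos by simp
  show "((n + m) * k + i) div (n + m) = k"
    unfolding div_mult_self4[OF \<open>n + m \<noteq> 0\<close>] div_less[OF assms] by (rule add_0_right)
  show "((n + m) * k + i) mod (n + m) = i"
    unfolding mod_mult_self4 mod_less[OF assms] ..
qed

lemma prev_bin_start_even_Suc:
  assumes "i < n"
  shows "prev_bin_start ((n + m) * Suc k + i) = (n + m) * k + n"
  unfolding prev_bin_start_def block_div_mod[OF trans_less_add1[OF assms]] using assms by simp

lemma prev_bin_start_odd:
  assumes "i < m"
  shows "prev_bin_start ((n + m) * k + n + i) = (n + m) * k"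
proof -
  have "n + i < n + m" using assms by simp
  then show ?thesis unfolding prev_bin_start_def add.assoc by (simp only: block_div_mod) simp
qed

lemma summand_gf_odd_bin:
  "summand_gf ((n + m) * Suc k) z =
     summand_gf ((n + m) * k + n) z + of_nat m * z * summand_gf ((n + m) * k) z"
proof -
  have "summand_gf ((n + m) * k + n + m) z =
      summand_gf ((n + m) * k + n) z + of_nat m * z * summand_gf ((n + m) * k) z"
    by (rule summand_gf_add_const) (rule prev_bin_start_odd)
  moreover have "(n + m) * Suc k = (n + m) * k + n + m" by simp
  ultimately show ?thesis by (simp only:)
qed

lemma summand_gf_even_bin:
  "summand_gf ((n + m) * Suc k + n) z =
     summand_gf ((n + m) * Suc k) z + of_nat n * z * summand_gf ((n + m) * k + n) z"
  by (rule summand_gf_add_const) (rule prev_bin_start_even_Suc)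

lemma summand_gf_block_1: "summand_gf (n + m) z = 1 + of_nat (n + m) * z"
proof -
  have "summand_gf (0 + n) z = summand_gf 0 z + of_nat n * z * summand_gf 0 z"
    by (rule summand_gf_add_const) (simp add: prev_bin_start_even_0)
  then show ?thesis
    using summand_gf_odd_bin[of 0 z] by (simp add: summand_gf_0 algebra_simps)
qed

text \<open>Eliminating the value \<open>h\<close> in the middle of a block from the one-bin steps
  leaves a recurrence over full blocks alone.\<close>

lemma summand_gf_block_Suc_Suc:
  "summand_gf ((n + m) * Suc (Suc k)) z =
     (1 + of_nat (n + m) * z) * summand_gf ((n + m) * Suc k) z
       - of_nat (n * m) * z\<^sup>2 * summand_gf ((n + m) * k) z"
proof -
  define f g h where "f = summand_gf ((n + m) * k) z" and "g = summand_gf ((n + m) * Suc k) z"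
    and "h = summand_gf ((n + m) * k + n) z"
  have h: "h = g - of_nat m * z * f"
    using summand_gf_odd_bin[of k z] by (simp only: f_def g_def h_def add_diff_cancel_right')
  have "summand_gf ((n + m) * Suc (Suc k)) z = g + of_nat n * z * h + of_nat m * z * g"
    unfolding summand_gf_odd_bin[of "Suc k"] summand_gf_even_bin f_def g_def h_def ..
  also have "\<dots> = (1 + of_nat (n + m) * z) * g - of_nat (n * m) * z\<^sup>2 * f"
    unfolding h by (simp add: algebra_simps power2_eq_square)
  finally show ?thesis by (simp only: f_def g_def)
qed

end

section \<open>Factorization of Chebyshev recurrences\<close>

text \<open>For nonzero \<open>b\<close> this is \<open>b^k U_k(X / (2 b))\<close>, where
  \<open>U_k\<close> is the Chebyshev polynomial of the second kind. It is monic of degree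
  \<open>k\<close>.\<close>

fun chebyshev_like :: "'a::comm_ring_1 \<Rightarrow> nat \<Rightarrow> 'a poly" where
  "chebyshev_like b 0 = 1"
| "chebyshev_like b (Suc 0) = [:0, 1:]"
| "chebyshev_like b (Suc (Suc k)) =
     [:0, 1:] * chebyshev_like b (Suc k) - Polynomial.smult (b\<^sup>2) (chebyshev_like b k)"

lemma degree_chebyshev_like:
  fixes b :: "'a::idom"
  shows "degree (chebyshev_like b k) \<le> k"
proof (induction b k rule: chebyshev_like.induct)
  case (3 b k)
  have "degree ([:0, 1:] * chebyshev_like b (Suc k)) \<le> Suc (Suc k)"
    using degree_mult_le[of "[:0, 1:]" "chebyshev_like b (Suc k)"] 3(1) by simp
  moreover have "degree (Polynomial.smult (b\<^sup>2) (chebyshev_like b k)) \<le> Suc (Suc k)"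
    using degree_smult_le[of "b\<^sup>2" "chebyshev_like b k"] 3(2) by simp
  ultimately show ?case by (simp only: chebyshev_like.simps degree_diff_le)
qed simp_all

lemma coeff_chebyshev_like:
  fixes b :: "'a::idom"
  shows "poly.coeff (chebyshev_like b k) k = 1"
proof (induction b k rule: chebyshev_like.induct)
  case (3 b k)
  have "poly.coeff (chebyshev_like b k) (Suc (Suc k)) = 0"
    using degree_chebyshev_like[of b k] by (intro coeff_eq_0) simp
  then show ?case using 3 by simp
qed simp_all

text \<open>The rescaled form of \<open>U_k(cos x) sin x = sin ((k + 1) x)\<close>, which follows by
  induction from the addition formulas for the sine.\<close>

lemma poly_chebyshev_like_cos:
  fixes b :: "'a::real_normed_field"
  shows "poly (chebyshev_like b k) (2 * b * of_real (cos \<theta>)) * of_real (sin \<theta>) =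
    b ^ k * of_real (sin (real (Suc k) * \<theta>))"
proof (induction b k rule: chebyshev_like.induct)
  case (2 b)
  have "sin (real (Suc (Suc 0)) * \<theta>) = 2 * sin \<theta> * cos \<theta>"
    using sin_double[of \<theta>] by simp
  then show ?case by simp
next
  case (3 b k)
  have "sin (real (Suc (Suc (Suc k))) * \<theta>) =
      2 * cos \<theta> * sin (real (Suc (Suc k)) * \<theta>) - sin (real (Suc k) * \<theta>)"
  proof -
    define \<phi> where "\<phi> = real (Suc (Suc k)) * \<theta>"
    have "real (Suc (Suc (Suc k))) * \<theta> = \<phi> + \<theta>" "real (Suc k) * \<theta> = \<phi> - \<theta>"
      by (simp_all add: \<phi>_def algebra_simps)
    then show ?thesis unfolding \<phi>_def[symmetric] by (simp add: sin_add sin_diff)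
  qed
  then have "b ^ Suc (Suc k) * of_real (sin (real (Suc (Suc (Suc k))) * \<theta>)) =
      2 * b * of_real (cos \<theta>) * (b ^ Suc k * of_real (sin (real (Suc (Suc k)) * \<theta>)))
      - b\<^sup>2 * (b ^ k * (of_real (sin (real (Suc k) * \<theta>)) :: 'a))"
    by (simp only: of_real_diff of_real_mult of_real_numeral) (simp add: algebra_simps power2_eq_square)
  also have "\<dots> = poly (chebyshev_like b (Suc (Suc k))) (2 * b * of_real (cos \<theta>)) * of_real (sin \<theta>)"
    unfolding 3[symmetric] by (simp add: algebra_simps)
  finally show ?case ..
qed simp

lemma chebyshev_like_factorization:
  fixes b :: "'a::real_normed_field"
  assumes "b \<noteq> 0"
  shows "chebyshev_like b k = (\<Prod>j=1..k. [:- (2 * b * of_real (cos (real j * pi / real (k + 1)))), 1:])"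
proof -
  define \<theta> where "\<theta> j = real j * pi / real (k + 1)" for j :: nat
  define r :: "nat \<Rightarrow> 'a" where "r j = 2 * b * of_real (cos (\<theta> j))" for j
  have angle: "0 < \<theta> j" "\<theta> j < pi" if "j \<in> {1..k}" for j
  proof -
    have "real j < k + 1" "0 < real j" using that by auto
    then have "0 < j / (k + 1) * pi" "j / (k + 1) * pi < 1 * pi"
      by (simp, intro mult_strict_right_mono) auto
    then show "0 < \<theta> j" "\<theta> j < pi" by (simp_all add: \<theta>_def)
  qed
  have inj: "inj_on r {1..k}"
  proof (rule inj_onI)
    fix i j assume ij: "i \<in> {1..k}" "j \<in> {1..k}" "r i = r j"
    then have "cos (\<theta> i) = cos (\<theta> j)"
      using assms by (simp add: r_def)
    then have "\<theta> i = \<theta> j"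
      using angle[OF ij(1)] angle[OF ij(2)] by (metis cos_inj_pi less_imp_le)
    then have "i * pi = j * pi" unfolding \<theta>_def by (simp only: divide_cancel_right) simp
    then show "i = j" by simp
  qed
  have deg: "degree (\<Prod>j=1..k. [:- r j, 1:]) = k"
    by (subst degree_prod_eq_sum_degree) auto
  have lead: "poly.coeff (\<Prod>j=1..k. [:- r j, 1:]) k = 1"
    using lead_coeff_prod[of "\<lambda>j. [:- r j, 1:]" "{1..k}"] deg by simp
  have "chebyshev_like b k = (\<Prod>j=1..k. [:- r j, 1:])"
  \<comment> \<open>Both sides have degree at most \<open>k\<close> and coefficient 1 at
    \<open>k\<close>, so agreement at the \<open>k\<close> distinct points \<open>r j\<close>
    suffices. They are distinct because the cosine is injective on [0, pi].\<close>
  proof (rule poly_eqI_degree_lead_coeff[where A = "r ` {1..k}" and n = k])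
    fix z assume "z \<in> r ` {1..k}"
    then obtain j where j: "j \<in> {1..k}" "z = r j" by auto
    have "real (Suc k) * \<theta> j = j * pi" by (simp add: \<theta>_def)
    then have "sin (real (Suc k) * \<theta> j) = 0" by (simp only: sin_npi)
    moreover have "sin (\<theta> j) \<noteq> 0"
      using sin_gt_zero[OF angle[OF j(1)]] by simp
    ultimately have "poly (chebyshev_like b k) z = 0"
      using poly_chebyshev_like_cos[of b k "\<theta> j"] j(2) unfolding r_def by simp
    moreover have "poly (\<Prod>j=1..k. [:- r j, 1:]) z = 0"
      using j by (auto simp: poly_prod intro: bexI[of _ j])
    ultimately show "poly (chebyshev_like b k) z = poly (\<Prod>j=1..k. [:- r j, 1:]) z" by simp
  qed (use deg lead card_image[OF inj] degree_chebyshev_like coeff_chebyshev_like in auto)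
  then show ?thesis by (simp add: r_def \<theta>_def)
qed

lemma chebyshev_like_recurrence_prod:
  fixes F :: "nat \<Rightarrow> 'a::real_normed_field"
  assumes "F 0 = 1" "F (Suc 0) = A" "\<And>k. F (Suc (Suc k)) = A * F (Suc k) - b\<^sup>2 * F k" "b \<noteq> 0"
  shows "F k = (\<Prod>j=1..k. A - 2 * b * of_real (cos (real j * pi / real (k + 1))))"
proof -
  have "F k = poly (chebyshev_like b k) A \<and> F (Suc k) = poly (chebyshev_like b (Suc k)) A"
    by (induction k) (simp_all add: assms)
  then show ?thesis
    unfolding chebyshev_like_factorization[OF assms(4)] by (simp add: poly_prod)
qed

section \<open>Central limit theorem for sums of independent Bernoulli variables\<close>

text \<open>A centred Bernoulli variable and a normal variable of the same variance have
  characteristic functions that agree to second order, so only Taylor remainders are left. The bound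
  is uniform in \<open>q\<close>.\<close>

lemma cmod_bernoulli_char_minus_normal_char:
  fixes q x :: real
  assumes "0 \<le> q" "q \<le> 1"
  shows "cmod (iexp (- (x * q)) * (1 - q + q * iexp x) - exp (- (q * (1 - q) * x\<^sup>2 / 2)))
    \<le> \<bar>x\<bar> ^ 3 + x ^ 4"
proof -
  define p where "p = 1 - q"
  have p: "0 \<le> p" "p \<le> 1" using assms by (auto simp: p_def)
  define R where "R u = iexp u - (1 + \<i> * u - u\<^sup>2 / 2)" for u :: real
  have R: "cmod (R u) \<le> \<bar>u\<bar> ^ 3 / 6" for u
  proof -
    have "(\<Sum>k\<le>2. (\<i> * u) ^ k / fact k) = 1 + \<i> * u - u\<^sup>2 / 2"
      by (simp add: numeral_2_eq_2 power_mult_distrib)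
    then show ?thesis using iexp_approx1[of u 2] by (simp add: R_def fact_numeral)
  qed
  \<comment> \<open>The centred variable is \<open>- q\<close> with probability \<open>p\<close> and
    \<open>p\<close> with probability \<open>q\<close>. Its mean 0 cancels the linear terms in
    \<open>expand\<close>, and its variance \<open>p * q\<close> gives the quadratic one.\<close>
  have q_char: "iexp (- (x * q)) * (1 - q + q * iexp x) = p * iexp (- (x * q)) + q * iexp (x * p)"
    by (simp add: p_def algebra_simps flip: exp_add)
  have expand: "iexp (- (x * q)) * (1 - q + q * iexp x) =
      1 - p * q * x\<^sup>2 / 2 + (p * R (- (x * q)) + q * R (x * p))"
    unfolding q_char R_def p_def
    by (simp add: algebra_simps power2_eq_square add_divide_distrib diff_divide_distrib)
  define v where "v = p * q * x\<^sup>2 / 2"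
  have "p * q \<le> 1" using mult_mono[of p 1 q 1] p assms by simp
  then have "p * q * x\<^sup>2 \<le> 1 * x\<^sup>2" by (intro mult_right_mono) auto
  moreover have v_ge: "0 \<le> v" using p assms by (simp add: v_def)
  ultimately have "v\<^sup>2 \<le> (x\<^sup>2)\<^sup>2" by (intro power_mono) (auto simp: v_def)
  then have v_sq: "v\<^sup>2 \<le> x ^ 4" by (simp flip: power_mult)
  \<comment> \<open>For \<open>v \<ge> 0\<close> the value \<open>exp (- v)\<close> lies between
    \<open>1 - v\<close> and \<open>1 / (1 + v)\<close>, and the latter is at most
    \<open>1 - v + v^2\<close>.\<close>
  have "\<bar>exp (- v) - (1 - v)\<bar> \<le> v\<^sup>2"
  proof -
    have "exp (- v) \<le> 1 / (1 + v)"
      using exp_ge_add_one_self[of v] v_ge by (simp add: exp_minus inverse_eq_divide frac_le)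
    also have "\<dots> \<le> 1 - v + v\<^sup>2"
      using v_ge by (simp add: divide_simps algebra_simps power2_eq_square)
    finally show ?thesis using exp_ge_add_one_self[of "- v"] by linarith
  qed
  then have exp_bound: "cmod (complex_of_real (1 - v - exp (- v))) \<le> x ^ 4"
    using v_sq unfolding norm_of_real by linarith
  have cube: "cmod (complex_of_real s * R (x * u)) \<le> \<bar>x\<bar> ^ 3 / 6"
    if "0 \<le> s" "s \<le> 1" "\<bar>u\<bar> \<le> 1" for s u
  proof -
    have "\<bar>x * u\<bar> ^ 3 \<le> \<bar>x\<bar> ^ 3"
      using that by (intro power_mono) (auto simp: abs_mult intro: mult_left_le)
    then have "cmod (R (x * u)) \<le> \<bar>x\<bar> ^ 3 / 6" using R[of "x * u"] by linarith
    then show ?thesis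
      using that mult_mono[of s 1 "cmod (R (x * u))" "\<bar>x\<bar> ^ 3 / 6"] by (simp add: norm_mult)
  qed
  have "iexp (- (x * q)) * (1 - q + q * iexp x) - exp (- (q * (1 - q) * x\<^sup>2 / 2)) =
      complex_of_real (1 - v - exp (- v)) + (complex_of_real p * R (x * (- q)) + complex_of_real q * R (x * p))"
    unfolding expand by (simp add: v_def p_def mult_ac flip: of_real_exp)
  also have "cmod \<dots> \<le> x ^ 4 + (\<bar>x\<bar> ^ 3 / 6 + \<bar>x\<bar> ^ 3 / 6)"
    using p assms by (intro norm_triangle_mono exp_bound cube) auto
  also have "\<dots> \<le> \<bar>x\<bar> ^ 3 + x ^ 4" by simp
  finally show ?thesis .
qed

text \<open>Only the characteristic function of \<open>X\<close> has to factor, so no independent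
  Bernoulli variables need to be constructed. With \<open>x = t / sqrt (V k)\<close> each of the
  \<open>k\<close> factors is off by at most \<open>|x|^3 + x^4\<close>, and linear growth of
  \<open>V\<close> makes the total error vanish.\<close>

lemma bernoulli_sum_clt:
  fixes P :: "nat \<Rightarrow> 'a pmf" and X :: "'a \<Rightarrow> real" and q :: "nat \<Rightarrow> nat \<Rightarrow> real"
  assumes q: "\<And>k j. j \<in> {1..k} \<Longrightarrow> 0 \<le> q k j \<and> q k j \<le> 1"
    and char_X: "\<And>k t. (CLINT x|measure_pmf (P k). iexp (t * X x)) =
      (\<Prod>j=1..k. 1 - complex_of_real (q k j) + q k j * iexp t)"
    and \<mu>: "\<And>k. \<mu> k = (\<Sum>j=1..k. q k j)"
    and V: "\<And>k. V k = (\<Sum>j=1..k. q k j * (1 - q k j))"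
    and lim: "(\<lambda>k. V k / k) \<longlonglongrightarrow> c" "0 < c"
  shows "weak_conv_m (\<lambda>k. distr (measure_pmf (P k)) borel (\<lambda>x. (X x - \<mu> k) / sqrt (V k)))
    std_normal_distribution"
proof (rule levy_continuity)
  show "real_distribution std_normal_distribution" by (rule real_dist_normal_dist)
  show "real_distribution (distr (measure_pmf (P k)) borel (\<lambda>x. (X x - \<mu> k) / sqrt (V k)))" for k
    by (rule prob_space.real_distribution_distr[OF measure_pmf.prob_space_axioms]) simp
next
  fix t :: real
  define x where "x k = t / sqrt (V k)" for k
  have char: "char (distr (measure_pmf (P k)) borel (\<lambda>x. (X x - \<mu> k) / sqrt (V k))) t =
      (\<Prod>j=1..k. iexp (- (x k * q k j)) * (1 - complex_of_real (q k j) + q k j * iexp (x k)))" for k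
  proof -
    have "char (distr (measure_pmf (P k)) borel (\<lambda>x. (X x - \<mu> k) / sqrt (V k))) t =
        (CLINT y|measure_pmf (P k). iexp (t * ((X y - \<mu> k) / sqrt (V k))))"
      unfolding char_def by (subst integral_distr) auto
    also have "\<dots> = (CLINT y|measure_pmf (P k). iexp (- (x k * \<mu> k)) * iexp (x k * X y))"
      by (intro Bochner_Integration.integral_cong refl)
        (simp add: x_def algebra_simps diff_divide_distrib flip: exp_add)
    also have "\<dots> = iexp (- (x k * \<mu> k)) * (\<Prod>j=1..k. 1 - complex_of_real (q k j) + q k j * iexp (x k))"
      by (simp only: integral_mult_right_zero char_X)
    also have "iexp (- (x k * \<mu> k)) = (\<Prod>j=1..k. iexp (- (x k * q k j)))"
      by (simp add: \<mu> sum_distrib_left sum_negf flip: exp_sum)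
    finally show ?thesis by (simp add: prod.distrib)
  qed
  define err where "err k = k * (\<bar>x k\<bar> ^ 3 + x k ^ 4)" for k
  have bound: "cmod (char (distr (measure_pmf (P k)) borel (\<lambda>x. (X x - \<mu> k) / sqrt (V k))) t
      - exp (- (t\<^sup>2 / 2))) \<le> err k" if "0 < V k" for k
  proof -
    \<comment> \<open>Since \<open>V k\<close> is the sum of the individual variances, the normal
      characteristic function splits into one factor for each \<open>j\<close>.\<close>
    have "exp (- (t\<^sup>2 / 2)) = exp (- (V k * (x k)\<^sup>2 / 2))"
      using that by (simp add: x_def power_divide)
    also have "\<dots> = (\<Prod>j=1..k. exp (- (q k j * (1 - q k j) * (x k)\<^sup>2 / 2)))"
      by (simp add: V sum_distrib_right sum_negf sum_divide_distrib flip: exp_sum)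
    finally have normal: "complex_of_real (exp (- (t\<^sup>2 / 2))) =
        (\<Prod>j=1..k. complex_of_real (exp (- (q k j * (1 - q k j) * (x k)\<^sup>2 / 2))))"
      by simp
    have "cmod (char (distr (measure_pmf (P k)) borel (\<lambda>x. (X x - \<mu> k) / sqrt (V k))) t
        - exp (- (t\<^sup>2 / 2))) \<le>
      (\<Sum>j=1..k. cmod (iexp (- (x k * q k j)) * (1 - complex_of_real (q k j) + q k j * iexp (x k))
        - exp (- (q k j * (1 - q k j) * (x k)\<^sup>2 / 2))))"
      unfolding char normal
    \<comment> \<open>Products of numbers in the closed unit disc differ by at most the sum of the
      differences of their factors.\<close>
    proof (rule norm_prod_diff)
      fix j assume j: "j \<in> {1..k}"
      have "cmod (complex_of_real (1 - q k j) + q k j * iexp (x k)) \<le> (1 - q k j) + q k j * 1"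
        using q[OF j] by (intro norm_triangle_mono) (auto simp: norm_mult norm_of_real simp del: of_real_diff)
      then show "cmod (iexp (- (x k * q k j)) * (1 - complex_of_real (q k j) + q k j * iexp (x k))) \<le> 1"
        by (simp add: norm_mult)
      show "cmod (complex_of_real (exp (- (q k j * (1 - q k j) * (x k)\<^sup>2 / 2)))) \<le> 1"
        using q[OF j] by simp
    qed
    also have "\<dots> \<le> (\<Sum>j=1..k. \<bar>x k\<bar> ^ 3 + x k ^ 4)"
      using q cmod_bernoulli_char_minus_normal_char by (intro sum_mono) simp
    also have "\<dots> = err k" by (simp add: err_def)
    finally show ?thesis .
  qed
  have V_top: "filterlim V at_top sequentially"
  proof -
    have "filterlim (\<lambda>k. V k / k * real k) at_top sequentially"
      by (rule filterlim_tendsto_pos_mult_at_top[OF lim filterlim_real_sequentially])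
    \<comment> \<open>At \<open>k = 0\<close> the quotient is 0 by convention, so the identity below
      relies on the empty sum.\<close>
    moreover have "V 0 = 0" by (simp add: V)
    then have "V k / k * real k = V k" for k by (cases "k = 0") simp_all
    ultimately show ?thesis by simp
  qed
  have V_pos: "eventually (\<lambda>k. 0 < V k) sequentially"
    using V_top by (simp add: filterlim_at_top_dense)
  have x_lim: "x \<longlonglongrightarrow> 0"
    unfolding x_def by (intro tendsto_divide_0[OF tendsto_const] filterlim_at_top_imp_at_infinity
      filterlim_compose[OF sqrt_at_top V_top])
  \<comment> \<open>The product \<open>k * (x k)^2\<close> equals \<open>t^2 / (V k / k)\<close>,
    which converges; the remaining factor tends to 0 with \<open>x k\<close>.\<close>
  have "(\<lambda>k. inverse (V k / k) * (t\<^sup>2 * (\<bar>x k\<bar> + (x k)\<^sup>2))) \<longlonglongrightarrow> inverse c * (t\<^sup>2 * (\<bar>0\<bar> + 0\<^sup>2))"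
    using lim by (intro tendsto_intros x_lim) auto
  moreover have "eventually (\<lambda>k. inverse (V k / k) * (t\<^sup>2 * (\<bar>x k\<bar> + (x k)\<^sup>2)) = err k) sequentially"
    using V_pos
  proof eventually_elim
    case (elim k)
    then have "(x k)\<^sup>2 = t\<^sup>2 / V k" by (simp add: x_def power_divide)
    moreover have "\<bar>x k\<bar> ^ 3 + x k ^ 4 = (x k)\<^sup>2 * (\<bar>x k\<bar> + (x k)\<^sup>2)"
      by (simp add: power2_eq_square power3_eq_cube power4_eq_xxxx algebra_simps abs_mult_self_eq)
    ultimately show ?case by (simp add: err_def)
  qed
  ultimately have err: "err \<longlonglongrightarrow> 0" by (simp add: tendsto_cong)
  have "(\<lambda>k. char (distr (measure_pmf (P k)) borel (\<lambda>x. (X x - \<mu> k) / sqrt (V k))) t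
      - exp (- (t\<^sup>2 / 2))) \<longlonglongrightarrow> 0"
    by (rule Lim_null_comparison[OF eventually_mono[OF V_pos bound] err])
  then show "(\<lambda>k. char (distr (measure_pmf (P k)) borel (\<lambda>x. (X x - \<mu> k) / sqrt (V k))) t)
      \<longlonglongrightarrow> char std_normal_distribution t"
    unfolding char_std_normal_distribution by (simp add: LIM_zero_iff)
qed

section \<open>Logarithmic derivatives of the closed form\<close>

text \<open>The sum is \<open>card A\<close> times the moment generating function, and the additive
  constant \<open>ln (card A)\<close> disappears on differentiation. Since derivatives are unique,
  any expression for the logarithm may be used; below, both the closed form and the factorization
  are.\<close>

lemma pmf_of_set_log_mgf:
  fixes f :: "'a \<Rightarrow> real"
  assumes A: "finite A" "A \<noteq> {}"
    and deriv1: "\<And>t. ((\<lambda>t. ln (\<Sum>x\<in>A. exp (t * f x))) has_real_derivative \<kappa> t) (at t)"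
    and deriv2: "(\<kappa> has_real_derivative v) (at 0)"
  shows "measure_pmf.expectation (pmf_of_set A) f = \<kappa> 0"
    and "measure_pmf.variance (pmf_of_set A) f = v"
proof -
  define M0 M1 M2 where "M0 t = (\<Sum>x\<in>A. exp (t * f x))" and "M1 t = (\<Sum>x\<in>A. f x * exp (t * f x))"
    and "M2 t = (\<Sum>x\<in>A. f x * f x * exp (t * f x))" for t
  have M0_pos: "0 < M0 t" for t unfolding M0_def using A by (intro sum_pos) auto
  have M0: "(M0 has_real_derivative M1 t) (at t)" for t
    unfolding M0_def M1_def by (auto intro!: derivative_eq_intros sum.cong)
  have M1: "(M1 has_real_derivative M2 t) (at t)" for t
    unfolding M1_def M2_def by (auto intro!: derivative_eq_intros sum.cong)
  have "((\<lambda>t. ln (M0 t)) has_real_derivative M1 t / M0 t) (at t)" for t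
    using M0_pos[of t] by (auto intro!: derivative_eq_intros M0)
  then have \<kappa>: "\<kappa> = (\<lambda>t. M1 t / M0 t)"
    using deriv1 DERIV_unique unfolding M0_def by blast
  have "((\<lambda>t. M1 t / M0 t) has_real_derivative (M2 0 * M0 0 - M1 0 * M1 0) / (M0 0 * M0 0)) (at 0)"
    using M0_pos[of 0] by (intro DERIV_divide M0 M1) simp
  then have v: "v = (M2 0 * M0 0 - M1 0 * M1 0) / (M0 0 * M0 0)"
    using deriv2 DERIV_unique unfolding \<kappa> by blast
  have M0_0: "M0 0 = card A" by (simp add: M0_def)
  have E: "measure_pmf.expectation (pmf_of_set A) g = (\<Sum>x\<in>A. g x) / card A" for g :: "'a \<Rightarrow> real"
    by (rule integral_pmf_of_set[OF A(2,1)])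
  show mean: "measure_pmf.expectation (pmf_of_set A) f = \<kappa> 0"
    unfolding E \<kappa> M0_0 by (simp add: M1_def)
  have "measure_pmf.variance (pmf_of_set A) f =
      measure_pmf.expectation (pmf_of_set A) (\<lambda>x. (f x)\<^sup>2) - (measure_pmf.expectation (pmf_of_set A) f)\<^sup>2"
    using A by (intro measure_pmf.variance_eq integrable_measure_pmf_finite) auto
  also have "\<dots> = v"
    unfolding mean unfolding E \<kappa> v using M0_pos[of 0] unfolding M0_0
    by (simp add: M2_def power2_eq_square divide_simps)
  finally show "measure_pmf.variance (pmf_of_set A) f = v" .
qed

lemma power_over_one_minus_power_limits:
  fixes r :: real
  assumes "0 < r" "r < 1"
  shows "(\<lambda>k. real (Suc k) * r ^ Suc k / (1 - r ^ Suc k)) \<longlonglongrightarrow> 0"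
    and "(\<lambda>k. (real (Suc k))\<^sup>2 * r ^ Suc k / (1 - r ^ Suc k)\<^sup>2) \<longlonglongrightarrow> 0"
proof -
  have lin: "(\<lambda>k. real (Suc k) * s ^ Suc k) \<longlonglongrightarrow> 0" if "0 < s" "s < 1" for s :: real
    using that LIMSEQ_Suc[OF powser_times_n_limit_0[of s]] by simp
  have pow: "(\<lambda>k. r ^ Suc k) \<longlonglongrightarrow> 0"
    using assms by (intro LIMSEQ_Suc LIMSEQ_realpow_zero) auto
  have "(\<lambda>k. real (Suc k) * r ^ Suc k / (1 - r ^ Suc k)) \<longlonglongrightarrow> 0 / (1 - 0)"
    by (intro tendsto_intros lin[OF assms] pow) simp
  then show "(\<lambda>k. real (Suc k) * r ^ Suc k / (1 - r ^ Suc k)) \<longlonglongrightarrow> 0" by simp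
  \<comment> \<open>Writing the numerator as the square of \<open>Suc k * sqrt r ^ Suc k\<close>
    reduces it to the limit \<open>lin\<close> at \<open>sqrt r\<close>.\<close>
  have "(\<lambda>k. (real (Suc k) * sqrt r ^ Suc k)\<^sup>2 / (1 - r ^ Suc k)\<^sup>2) \<longlonglongrightarrow> 0\<^sup>2 / (1 - 0)\<^sup>2"
    using assms by (intro tendsto_intros lin pow) auto
  moreover have "(real (Suc k) * sqrt r ^ Suc k)\<^sup>2 = (real (Suc k))\<^sup>2 * r ^ Suc k" for k
    using assms unfolding power_mult_distrib
    by (metis less_imp_le power_mult mult.commute real_sqrt_pow2)
  ultimately show "(\<lambda>k. (real (Suc k))\<^sup>2 * r ^ Suc k / (1 - r ^ Suc k)\<^sup>2) \<longlonglongrightarrow> 0" by simp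
qed

text \<open>Used with \<open>K = n + m\<close> and \<open>p = n * m\<close>. Then
  \<open>disc\<close> is the inequality of arithmetic and geometric means, and it keeps the
  characteristic roots real for every \<open>t\<close>.\<close>

locale quadratic_recurrence =
  fixes K p :: real
  assumes K_pos: "0 < K" and p_pos: "0 < p" and disc: "4 * p \<le> K\<^sup>2"
begin

text \<open>
  \<open>root_p\<close> and \<open>root_m\<close> are the roots of \<open>X\<^sup>2 - (1 + K y) X + p y\<^sup>2\<close> at \<open>y = exp t\<close>, and
  \<open>delta\<close> is their difference. In the variable \<open>t\<close> their logarithmic derivatives
  are \<open>1 - 1 / delta\<close> and \<open>1 + 1 / delta\<close>.
\<close>

definition delta :: "real \<Rightarrow> real" where
  "delta t = sqrt ((1 + K * exp t)\<^sup>2 - 4 * p * (exp t)\<^sup>2)"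

definition root_p :: "real \<Rightarrow> real" where "root_p t = (1 + K * exp t + delta t) / 2"
definition root_m :: "real \<Rightarrow> real" where "root_m t = (1 + K * exp t - delta t) / 2"
definition ratio :: "real \<Rightarrow> real" where "ratio t = root_m t / root_p t"

text \<open>Half the derivative of \<open>(delta t)^2\<close>, so that \<open>delta\<close> has
  derivative \<open>eps t / delta t\<close>.\<close>

definition eps :: "real \<Rightarrow> real" where "eps t = K * exp t + (K\<^sup>2 - 4 * p) * (exp t)\<^sup>2"

section \<open>The characteristic roots and their derivatives\<close>

lemma delta_arg: "(1 + K * exp t)\<^sup>2 - 4 * p * (exp t)\<^sup>2 = 1 + K * exp t + eps t"
  by (simp add: eps_def power2_eq_square algebra_simps)

lemma eps_pos: "0 < eps t"
  using K_pos disc by (auto simp: eps_def intro!: add_pos_nonneg)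

lemma delta_sq: "(delta t)\<^sup>2 = 1 + K * exp t + eps t"
  unfolding delta_def delta_arg using eps_pos[of t] K_pos
  by (intro real_sqrt_pow2) (auto intro!: add_nonneg_nonneg)

lemma delta_gt_1: "1 < delta t"
proof -
  have "0 < K * exp t" using K_pos by simp
  then show ?thesis unfolding delta_def delta_arg
    using eps_pos[of t] by (intro real_less_rsqrt) simp
qed

lemma root_p_pos: "0 < root_p t"
proof -
  have "0 < K * exp t" using K_pos by simp
  then show ?thesis using delta_gt_1[of t] unfolding root_p_def by (intro half_gt_zero) linarith
qed

lemma root_m_pos: "0 < root_m t"
proof -
  have y: "0 < K * exp t" using K_pos by simp
  have "delta t < 1 + K * exp t"
    unfolding delta_def using p_pos y by (intro real_less_lsqrt) auto
  then show ?thesis by (simp add: root_m_def)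
qed

lemma ratio_bounds: "0 < ratio t" "ratio t < 1"
  using root_p_pos[of t] root_m_pos[of t] delta_gt_1[of t]
  by (auto simp: ratio_def) (simp add: root_p_def root_m_def)

lemma DERIV_eps: "(eps has_real_derivative (K * exp t + 2 * (K\<^sup>2 - 4 * p) * (exp t)\<^sup>2)) (at t)"
  unfolding eps_def by (auto intro!: derivative_eq_intros simp: power2_eq_square)

lemma DERIV_delta: "(delta has_real_derivative eps t / delta t) (at t)"
proof -
  have delta: "delta = (\<lambda>t. sqrt (1 + K * exp t + eps t))"
    by (simp add: fun_eq_iff delta_def delta_arg)
  have "((\<lambda>t. 1 + K * exp t + eps t) has_real_derivative 2 * eps t) (at t)"
    by (auto intro!: derivative_eq_intros DERIV_eps simp: eps_def power2_eq_square algebra_simps)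
  moreover have "0 < 1 + K * exp t + eps t"
    using delta_gt_1[of t] unfolding delta_sq[symmetric] by simp
  ultimately have "((\<lambda>t. sqrt (1 + K * exp t + eps t)) has_real_derivative
      inverse (sqrt (1 + K * exp t + eps t)) / 2 * (2 * eps t)) (at t)"
    by (intro DERIV_chain2[OF DERIV_real_sqrt])
  then show ?thesis
    unfolding delta by (rule DERIV_cong) (simp add: inverse_eq_divide)
qed

lemma DERIV_root_p: "(root_p has_real_derivative root_p t * (1 - 1 / delta t)) (at t)"
proof -
  have "(root_p has_real_derivative (K * exp t + eps t / delta t) / 2) (at t)"
    unfolding root_p_def by (auto intro!: derivative_eq_intros DERIV_delta)
  \<comment> \<open>Multiplying out the right-hand side leaves
    \<open>(delta t)^2 - 1 - K * exp t\<close>, which is \<open>eps t\<close>.\<close>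
  moreover have "(K * exp t + eps t / delta t) / 2 = root_p t * (1 - 1 / delta t)"
    using delta_gt_1[of t] delta_sq[of t]
    by (simp add: root_p_def field_simps power2_eq_square)
  ultimately show ?thesis by simp
qed

lemma DERIV_root_m: "(root_m has_real_derivative root_m t * (1 + 1 / delta t)) (at t)"
proof -
  have "(root_m has_real_derivative (K * exp t - eps t / delta t) / 2) (at t)"
    unfolding root_m_def by (auto intro!: derivative_eq_intros DERIV_delta)
  moreover have "(K * exp t - eps t / delta t) / 2 = root_m t * (1 + 1 / delta t)"
    using delta_gt_1[of t] delta_sq[of t]
    by (simp add: root_m_def field_simps power2_eq_square)
  ultimately show ?thesis by simp
qed

lemma DERIV_ratio: "(ratio has_real_derivative 2 * ratio t / delta t) (at t)"
proof -
  have "(ratio has_real_derivative (root_m t * (1 + 1 / delta t) * root_p t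
      - root_m t * (root_p t * (1 - 1 / delta t))) / (root_p t * root_p t)) (at t)"
    unfolding ratio_def using root_p_pos[of t] by (intro DERIV_divide DERIV_root_p DERIV_root_m) simp
  moreover have "(root_m t * (1 + 1 / delta t) * root_p t
      - root_m t * (root_p t * (1 - 1 / delta t))) / (root_p t * root_p t) = 2 * ratio t / delta t"
    using root_p_pos[of t] delta_gt_1[of t] by (simp add: ratio_def field_simps)
  ultimately show ?thesis by simp
qed

text \<open>The three terms come from the power of \<open>root_p\<close>, from the correction by the
  smaller root, and from the denominator \<open>delta\<close>. At fixed \<open>t\<close> only the
  first grows with \<open>k\<close>.\<close>

definition log_deriv :: "nat \<Rightarrow> real \<Rightarrow> real" where
  "log_deriv k t = real (Suc k) * (1 - 1 / delta t)
     - 2 * real (Suc k) / delta t * (ratio t ^ Suc k / (1 - ratio t ^ Suc k)) - eps t / (delta t)\<^sup>2"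

text \<open>The derivative of \<open>log_deriv k\<close> at 0, sorted by size: the first term is
  linear in \<open>Suc k\<close>, the next two tend to 0, and the last is constant in
  \<open>k\<close>.\<close>

definition log_deriv2_0 :: "nat \<Rightarrow> real" where
  "log_deriv2_0 k = real (Suc k) * eps 0 / delta 0 ^ 3
     + 2 * eps 0 / delta 0 ^ 3 * (real (Suc k) * ratio 0 ^ Suc k / (1 - ratio 0 ^ Suc k))
     - 4 / (delta 0)\<^sup>2 * ((real (Suc k))\<^sup>2 * ratio 0 ^ Suc k / (1 - ratio 0 ^ Suc k)\<^sup>2)
     - ((K + 2 * (K\<^sup>2 - 4 * p)) * (delta 0)\<^sup>2 - 2 * (eps 0)\<^sup>2) / delta 0 ^ 4"

lemma ratio_power_less_1: "ratio t ^ Suc k < 1"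
  using ratio_bounds[of t] by (intro power_Suc_less_one) auto

lemma DERIV_ratio_power:
  "((\<lambda>t. ratio t ^ Suc k) has_real_derivative 2 * real (Suc k) / delta t * ratio t ^ Suc k) (at t)"
  by (auto intro!: derivative_eq_intros DERIV_ratio simp del: power_Suc) (simp add: field_simps)

lemma DERIV_log_closed_form:
  "((\<lambda>t. ln (root_p t ^ Suc k * (1 - ratio t ^ Suc k) / delta t))
     has_real_derivative log_deriv k t) (at t)"
proof -
  have "(\<lambda>t. ln (root_p t ^ Suc k * (1 - ratio t ^ Suc k) / delta t)) =
      (\<lambda>t. real (Suc k) * ln (root_p t) + ln (1 - ratio t ^ Suc k) - ln (delta t))"
  proof
    fix t
    show "ln (root_p t ^ Suc k * (1 - ratio t ^ Suc k) / delta t) =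
        real (Suc k) * ln (root_p t) + ln (1 - ratio t ^ Suc k) - ln (delta t)"
      using root_p_pos[of t] ratio_power_less_1[of t k] delta_gt_1[of t]
      by (simp add: ln_div ln_mult ln_realpow del: power_Suc)
  qed
  moreover have "((\<lambda>t. real (Suc k) * ln (root_p t)) has_real_derivative
      real (Suc k) * (1 - 1 / delta t)) (at t)"
    using root_p_pos[of t] by (auto intro!: derivative_eq_intros DERIV_root_p)
  moreover have "((\<lambda>t. ln (1 - ratio t ^ Suc k)) has_real_derivative
      - (2 * real (Suc k) / delta t * (ratio t ^ Suc k / (1 - ratio t ^ Suc k)))) (at t)"
  proof -
    have "((\<lambda>t. 1 - ratio t ^ Suc k) has_real_derivative
        0 - 2 * real (Suc k) / delta t * ratio t ^ Suc k) (at t)"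
      by (intro DERIV_diff DERIV_const DERIV_ratio_power)
    then have "((\<lambda>t. ln (1 - ratio t ^ Suc k)) has_real_derivative
        1 / (1 - ratio t ^ Suc k) * (0 - 2 * real (Suc k) / delta t * ratio t ^ Suc k)) (at t)"
      using ratio_power_less_1[of t k] by (intro DERIV_chain2[OF DERIV_ln_divide]) simp_all
    then show ?thesis by (rule DERIV_cong) (simp del: power_Suc add: mult_ac)
  qed
  moreover have "((\<lambda>t. ln (delta t)) has_real_derivative eps t / (delta t)\<^sup>2) (at t)"
    using delta_gt_1[of t] by (auto intro!: derivative_eq_intros DERIV_delta simp: power2_eq_square)
  ultimately have "((\<lambda>t. ln (root_p t ^ Suc k * (1 - ratio t ^ Suc k) / delta t)) has_real_derivative
      real (Suc k) * (1 - 1 / delta t)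
      + - (2 * real (Suc k) / delta t * (ratio t ^ Suc k / (1 - ratio t ^ Suc k)))
      - eps t / (delta t)\<^sup>2) (at t)"
    by (simp only: DERIV_add DERIV_diff)
  then show ?thesis unfolding log_deriv_def by (simp only: add_uminus_conv_diff)
qed

lemma DERIV_log_deriv: "(log_deriv k has_real_derivative log_deriv2_0 k) (at 0)"
proof -
  define N where "N = real (Suc k)"
  define w where "w t = ratio t ^ Suc k" for t
  have w: "(w has_real_derivative 2 * N / delta 0 * w 0) (at 0)"
    unfolding w_def N_def by (rule DERIV_ratio_power)
  have w_less: "w 0 < 1" unfolding w_def by (rule ratio_power_less_1)
  define u v h where "u t = 1 / delta t" and "v t = w t / (1 - w t)" and "h t = eps t / (delta t)\<^sup>2" for t
  have u: "(u has_real_derivative - (eps 0 / delta 0 ^ 3)) (at 0)"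
    unfolding u_def using delta_gt_1[of 0]
    by (auto intro!: derivative_eq_intros DERIV_delta simp: power3_eq_cube power2_eq_square)
  have v: "(v has_real_derivative 2 * N / delta 0 * w 0 / (1 - w 0)\<^sup>2) (at 0)"
    unfolding v_def using w_less by (auto intro!: derivative_eq_intros w simp: power2_eq_square)
      (simp add: divide_simps, simp add: algebra_simps)
  have e: "(eps has_real_derivative K + 2 * (K\<^sup>2 - 4 * p)) (at 0)"
    using DERIV_eps[of 0] by simp
  have h: "(h has_real_derivative
      ((K + 2 * (K\<^sup>2 - 4 * p)) * (delta 0)\<^sup>2 - 2 * (eps 0)\<^sup>2) / delta 0 ^ 4) (at 0)"
    unfolding h_def using delta_gt_1[of 0] by (auto intro!: derivative_eq_intros e DERIV_delta
        simp: power2_eq_square power4_eq_xxxx mult_ac)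
  have "((\<lambda>t. N * (1 - u t) - 2 * N * u t * v t - h t)
      has_real_derivative
        N * (eps 0 / delta 0 ^ 3)
        - (2 * N * (- (eps 0 / delta 0 ^ 3)) * v 0
           + 2 * N * u 0 * (2 * N / delta 0 * w 0 / (1 - w 0)\<^sup>2))
        - ((K + 2 * (K\<^sup>2 - 4 * p)) * (delta 0)\<^sup>2 - 2 * (eps 0)\<^sup>2) / delta 0 ^ 4) (at 0)"
    by (rule derivative_eq_intros u v h refl)+ (simp add: mult.commute mult.left_commute)
  moreover have "log_deriv k = (\<lambda>t. N * (1 - u t) - 2 * N * u t * v t - h t)"
    by (simp add: fun_eq_iff log_deriv_def N_def w_def u_def v_def h_def)
  moreover have "log_deriv2_0 k =
        N * (eps 0 / delta 0 ^ 3)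
        - (2 * N * (- (eps 0 / delta 0 ^ 3)) * v 0
           + 2 * N * u 0 * (2 * N / delta 0 * w 0 / (1 - w 0)\<^sup>2))
        - ((K + 2 * (K\<^sup>2 - 4 * p)) * (delta 0)\<^sup>2 - 2 * (eps 0)\<^sup>2) / delta 0 ^ 4"
    unfolding log_deriv2_0_def N_def[symmetric] w_def[symmetric] u_def v_def
    by (simp add: power2_eq_square mult_ac)
  ultimately show ?thesis by simp
qed

text \<open>A Binet formula: \<open>F k\<close> is \<open>(x^(k+1) - y^(k+1)) / (x - y)\<close> for
  the roots \<open>x\<close> and \<open>y\<close>. Factoring out the larger root isolates an
  exponentially small correction.\<close>

lemma recurrence_closed_form:
  assumes F: "F 0 = 1" "F (Suc 0) = 1 + K * exp t"
    "\<And>k. F (Suc (Suc k)) = (1 + K * exp t) * F (Suc k) - p * (exp t)\<^sup>2 * F k"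
  shows "F k = root_p t ^ Suc k * (1 - ratio t ^ Suc k) / delta t"
proof -
  define x y where "x = root_p t" and "y = root_m t"
  have sum: "1 + K * exp t = x + y" and diff: "delta t = x - y"
    by (simp_all add: x_def y_def root_p_def root_m_def field_simps)
  have "x * y = ((1 + K * exp t)\<^sup>2 - (delta t)\<^sup>2) / 4"
    by (simp add: x_def y_def root_p_def root_m_def field_simps power2_eq_square)
  also have "\<dots> = p * (exp t)\<^sup>2"
    unfolding delta_sq using delta_arg[of t] by simp
  finally have prod: "p * (exp t)\<^sup>2 = x * y" ..
  have "F k * (x - y) = x ^ Suc k - y ^ Suc k \<and> F (Suc k) * (x - y) = x ^ Suc (Suc k) - y ^ Suc (Suc k)"
  proof (induction k)
    case 0
    then show ?case using F(1,2) sum by (simp add: algebra_simps)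
  next
    case (Suc k)
    have "F (Suc (Suc k)) * (x - y) = (x + y) * (F (Suc k) * (x - y)) - x * y * (F k * (x - y))"
      unfolding F(3) sum prod by (simp add: algebra_simps)
    also have "\<dots> = x ^ Suc (Suc (Suc k)) - y ^ Suc (Suc (Suc k))"
      unfolding Suc.IH[THEN conjunct1] Suc.IH[THEN conjunct2] by (simp add: algebra_simps)
    finally show ?case using Suc.IH by simp
  qed
  moreover have "x ^ Suc k * (1 - ratio t ^ Suc k) = x ^ Suc k - y ^ Suc k"
    using root_p_pos[of t]
    by (simp add: ratio_def x_def y_def power_divide algebra_simps del: power_Suc)
  ultimately have "F k * delta t = root_p t ^ Suc k * (1 - ratio t ^ Suc k)"
    unfolding diff x_def[symmetric] by (simp only:)
  then show ?thesis
    using delta_gt_1[of t] by (simp add: eq_divide_eq del: power_Suc)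
qed

lemma log_deriv_asymp:
  "(\<lambda>k. log_deriv k 0 - (1 - 1 / delta 0) * real k) \<in> O(\<lambda>k. 1)"
proof (rule bigoI_tendsto)
  have "(\<lambda>k. (1 - 1 / delta 0) - 2 / delta 0 * (real (Suc k) * ratio 0 ^ Suc k / (1 - ratio 0 ^ Suc k))
      - eps 0 / (delta 0)\<^sup>2) \<longlonglongrightarrow> (1 - 1 / delta 0) - 2 / delta 0 * 0 - eps 0 / (delta 0)\<^sup>2"
    by (intro tendsto_intros power_over_one_minus_power_limits ratio_bounds)
  moreover have "(1 - 1 / delta 0) - 2 / delta 0 * (real (Suc k) * ratio 0 ^ Suc k / (1 - ratio 0 ^ Suc k))
      - eps 0 / (delta 0)\<^sup>2 = (log_deriv k 0 - (1 - 1 / delta 0) * real k) / 1" for k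
  proof -
    have frac: "2 / delta 0 * (N * W / V) = 2 * N / delta 0 * (W / V)" for N W V :: real
      by simp
    \<comment> \<open>The constant multiplies \<open>Suc k\<close>, so removing \<open>k\<close>
      copies leaves one, which goes into the limit of the remainder.\<close>
    have "real (Suc k) * (1 - 1 / delta 0) = (1 - 1 / delta 0) + (1 - 1 / delta 0) * real k"
      by (simp add: algebra_simps add_divide_distrib)
    moreover have cancel: "A + B - C - D - B = A - C - D" for A B C D :: real
      by simp
    ultimately show ?thesis unfolding log_deriv_def frac div_by_1 by (simp only: cancel)
  qed
  ultimately show "(\<lambda>k. (log_deriv k 0 - (1 - 1 / delta 0) * real k) / 1) \<longlonglongrightarrow>
      (1 - 1 / delta 0) - 2 / delta 0 * 0 - eps 0 / (delta 0)\<^sup>2"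
    by (simp only:)
qed simp

lemma log_deriv2_asymp:
  "(\<lambda>k. log_deriv2_0 k - eps 0 / delta 0 ^ 3 * real k) \<in> O(\<lambda>k. 1)"
proof (rule bigoI_tendsto)
  define d where "d = ((K + 2 * (K\<^sup>2 - 4 * p)) * (delta 0)\<^sup>2 - 2 * (eps 0)\<^sup>2) / delta 0 ^ 4"
  have "(\<lambda>k. eps 0 / delta 0 ^ 3
      + 2 * eps 0 / delta 0 ^ 3 * (real (Suc k) * ratio 0 ^ Suc k / (1 - ratio 0 ^ Suc k))
      - 4 / (delta 0)\<^sup>2 * ((real (Suc k))\<^sup>2 * ratio 0 ^ Suc k / (1 - ratio 0 ^ Suc k)\<^sup>2) - d)
      \<longlonglongrightarrow> eps 0 / delta 0 ^ 3 + 2 * eps 0 / delta 0 ^ 3 * 0 - 4 / (delta 0)\<^sup>2 * 0 - d"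
    by (intro tendsto_intros power_over_one_minus_power_limits ratio_bounds)
  moreover have "eps 0 / delta 0 ^ 3
      + 2 * eps 0 / delta 0 ^ 3 * (real (Suc k) * ratio 0 ^ Suc k / (1 - ratio 0 ^ Suc k))
      - 4 / (delta 0)\<^sup>2 * ((real (Suc k))\<^sup>2 * ratio 0 ^ Suc k / (1 - ratio 0 ^ Suc k)\<^sup>2) - d =
      (log_deriv2_0 k - eps 0 / delta 0 ^ 3 * real k) / 1" for k
  proof -
    have "real (Suc k) * eps 0 / delta 0 ^ 3 = eps 0 / delta 0 ^ 3 + eps 0 / delta 0 ^ 3 * real k"
      by (simp add: algebra_simps add_divide_distrib)
    then show ?thesis unfolding log_deriv2_0_def d_def by simp
  qed
  ultimately show "(\<lambda>k. (log_deriv2_0 k - eps 0 / delta 0 ^ 3 * real k) / 1) \<longlonglongrightarrow>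
      eps 0 / delta 0 ^ 3 + 2 * eps 0 / delta 0 ^ 3 * 0 - 4 / (delta 0)\<^sup>2 * 0 - d"
    by (simp only:)
qed simp

end

section \<open>Asymptotics of the number of summands\<close>

context bin_sequence
begin

text \<open>Divided by its value at 1, a factor \<open>1 + c * z\<close> is the generating function
  of a Bernoulli variable with odds \<open>c\<close>, that is, with success probability
  \<open>c / (1 + c)\<close>.\<close>

definition bernoulli_odds :: "nat \<Rightarrow> nat \<Rightarrow> real" where
  "bernoulli_odds k j =
     real (n + m) - 2 * sqrt (real (n * m)) * cos (real j * pi / real (k + 1))"

lemma bernoulli_odds_nonneg: "0 \<le> bernoulli_odds k j"
proof -
  have "sqrt (real (n * m)) * cos (real j * pi / real (k + 1)) \<le> sqrt (real (n * m)) * 1"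
    by (intro mult_left_mono cos_le_one) simp
  moreover have "2 * sqrt (real (n * m)) \<le> real (n + m)"
    using arith_geo_mean_sqrt[of "real n" "real m"] by (simp add: field_simps)
  ultimately show ?thesis unfolding bernoulli_odds_def by linarith
qed

text \<open>The Chebyshev recurrence with \<open>A = 1 + (n + m) z\<close> and
  \<open>b = sqrt (n m) z\<close>. Since \<open>z\<close> is nonzero, so is \<open>b\<close>, as the
  factorization requires.\<close>

lemma summand_gf_factorization:
  fixes z :: "'b::real_normed_field"
  assumes "z \<noteq> 0"
  shows "summand_gf ((n + m) * k) z = (\<Prod>j=1..k. 1 + of_real (bernoulli_odds k j) * z)"
proof -
  define b :: 'b where "b = of_real (sqrt (real (n * m))) * z"
  have "b\<^sup>2 = of_real ((sqrt (real (n * m)))\<^sup>2) * z\<^sup>2"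
    by (simp only: b_def power_mult_distrib of_real_power)
  then have b_sq: "b\<^sup>2 = of_nat (n * m) * z\<^sup>2" by simp
  have "b \<noteq> 0" using n_pos m_pos assms by (simp add: b_def)
  have "summand_gf ((n + m) * k) z =
      (\<Prod>j=1..k. 1 + of_nat (n + m) * z - 2 * b * of_real (cos (real j * pi / real (k + 1))))"
  proof (rule chebyshev_like_recurrence_prod[where F = "\<lambda>k. summand_gf ((n + m) * k) z"])
    show "summand_gf ((n + m) * Suc (Suc k)) z = (1 + of_nat (n + m) * z) * summand_gf ((n + m) * Suc k) z
        - b\<^sup>2 * summand_gf ((n + m) * k) z" for k
      unfolding b_sq by (rule summand_gf_block_Suc_Suc)
  qed (simp_all only: summand_gf_0 summand_gf_block_1 mult_0_right mult_Suc_right add_0_right \<open>b \<noteq> 0\<close>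
      not_False_eq_True)
  also have "\<dots> = (\<Prod>j=1..k. 1 + of_real (bernoulli_odds k j) * z)"
    by (intro prod.cong refl) (simp add: bernoulli_odds_def b_def algebra_simps)
  finally show ?thesis .
qed

sublocale quadratic_recurrence "real (n + m)" "real (n * m)"
proof
  show "4 * real (n * m) \<le> (real (n + m))\<^sup>2"
    using sum_squares_ge_zero[of "real n - real m" 0] by (simp add: power2_eq_square algebra_simps)
qed (use n_pos m_pos in auto)

lemma summand_gf_exp:
  "(\<Sum>N\<in>{0..<a x}. exp (t * Y n m a N)) = summand_gf x (exp t)"
  by (simp add: summand_gf_def Y_def atLeast0LessThan mult.commute flip: exp_of_nat_mult)

lemma summand_gf_closed_form:
  "summand_gf ((n + m) * k) (exp t) = root_p t ^ Suc k * (1 - ratio t ^ Suc k) / delta t"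
proof (rule recurrence_closed_form[where F = "\<lambda>k. summand_gf ((n + m) * k) (exp t)"])
  show "summand_gf ((n + m) * Suc (Suc k)) (exp t) =
      (1 + real (n + m) * exp t) * summand_gf ((n + m) * Suc k) (exp t)
        - real (n * m) * (exp t)\<^sup>2 * summand_gf ((n + m) * k) (exp t)" for k
    by (rule summand_gf_block_Suc_Suc)
qed (simp_all only: summand_gf_0 summand_gf_block_1 mult_0_right mult_Suc_right add_0_right)

section \<open>Moments and characteristic function of the number of summands\<close>

lemma support: "finite {0..<a x}" "{0..<a x} \<noteq> {}"
  using a_pos[of x] by auto

lemma mean_Y_eq: "mean_Y n m a k = log_deriv k 0"
  and var_Y_eq: "var_Y n m a k = log_deriv2_0 k"
proof -
  have "((\<lambda>t. ln (\<Sum>N\<in>{0..<a ((n + m) * k)}. exp (t * Y n m a N))) has_real_derivative log_deriv k t)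
      (at t)" for t
    unfolding summand_gf_exp summand_gf_closed_form by (rule DERIV_log_closed_form)
  note moments = pmf_of_set_log_mgf[OF support this DERIV_log_deriv]
  show "mean_Y n m a k = log_deriv k 0" "var_Y n m a k = log_deriv2_0 k"
    unfolding mean_Y_def var_Y_def uniform_below_def using moments by simp_all
qed

definition bernoulli_prob :: "nat \<Rightarrow> nat \<Rightarrow> real" where
  "bernoulli_prob k j = bernoulli_odds k j / (1 + bernoulli_odds k j)"

text \<open>The same cumulants, now from the factorization. This identifies the centring and scaling
  in \<open>normalized_Y\<close> with those of the Bernoulli sum.\<close>

lemma mean_Y_bernoulli: "mean_Y n m a k = (\<Sum>j=1..k. bernoulli_prob k j)"
  and var_Y_bernoulli: "var_Y n m a k = (\<Sum>j=1..k. bernoulli_prob k j * (1 - bernoulli_prob k j))"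
proof -
  define c where "c = bernoulli_odds k"
  define \<kappa> where "\<kappa> t = (\<Sum>j=1..k. c j * exp t / (1 + c j * exp t))" for t
  have pos: "0 < 1 + c j * exp t" for j t
    using bernoulli_odds_nonneg[of k j] by (simp add: c_def add_pos_nonneg)
  have log_gf: "ln (\<Sum>N\<in>{0..<a ((n + m) * k)}. exp (t * Y n m a N)) = (\<Sum>j=1..k. ln (1 + c j * exp t))" for t
    unfolding summand_gf_exp using pos
    by (subst summand_gf_factorization) (auto simp: c_def[symmetric] ln_prod less_imp_neq[THEN not_sym])
  have deriv1: "((\<lambda>t. ln (\<Sum>N\<in>{0..<a ((n + m) * k)}. exp (t * Y n m a N))) has_real_derivative \<kappa> t) (at t)" for t
    unfolding log_gf \<kappa>_def using pos
    by (intro DERIV_sum) (auto intro!: derivative_eq_intros)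
  have "((\<lambda>t. c j * exp t / (1 + c j * exp t)) has_real_derivative
      bernoulli_prob k j * (1 - bernoulli_prob k j)) (at 0)" for j
    using pos[of j 0]
    by (auto intro!: derivative_eq_intros simp: bernoulli_prob_def c_def[symmetric])
      (simp add: divide_simps, simp add: algebra_simps)
  then have deriv2: "(\<kappa> has_real_derivative (\<Sum>j=1..k. bernoulli_prob k j * (1 - bernoulli_prob k j))) (at 0)"
    unfolding \<kappa>_def by (intro DERIV_sum)
  note moments = pmf_of_set_log_mgf[OF support deriv1 deriv2]
  show "mean_Y n m a k = (\<Sum>j=1..k. bernoulli_prob k j)"
    "var_Y n m a k = (\<Sum>j=1..k. bernoulli_prob k j * (1 - bernoulli_prob k j))"
    unfolding mean_Y_def var_Y_def uniform_below_def using moments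
    by (simp_all add: \<kappa>_def c_def bernoulli_prob_def)
qed

lemma char_Y:
  "(CLINT N|measure_pmf (uniform_below n m a k). iexp (t * Y n m a N)) =
     (\<Prod>j=1..k. 1 - complex_of_real (bernoulli_prob k j) + bernoulli_prob k j * iexp t)"
proof -
  define c where "c = bernoulli_odds k"
  have pos: "0 < 1 + c j" for j using bernoulli_odds_nonneg[of k j] by (simp add: c_def)
  have "(CLINT N|measure_pmf (uniform_below n m a k). iexp (t * Y n m a N)) =
      (\<Sum>N\<in>{0..<a ((n + m) * k)}. iexp (t * Y n m a N)) / card {0..<a ((n + m) * k)}"
    unfolding uniform_below_def
    by (subst integral_measure_pmf[of "{0..<a ((n + m) * k)}"])
      (use support in \<open>auto simp: sum_divide_distrib scaleR_conv_of_real\<close>)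
  also have "(\<Sum>N\<in>{0..<a ((n + m) * k)}. iexp (t * Y n m a N)) = summand_gf ((n + m) * k) (iexp t)"
    by (simp add: summand_gf_def Y_def atLeast0LessThan mult_ac flip: exp_of_nat_mult)
  \<comment> \<open>At 1 every power is 1, so the generating function counts the integers and serves
    as the normalizing constant.\<close>
  also have "complex_of_nat (card {0..<a ((n + m) * k)}) = summand_gf ((n + m) * k) 1"
    by (simp add: summand_gf_def)
  also have "summand_gf ((n + m) * k) (iexp t) / summand_gf ((n + m) * k) 1 =
      (\<Prod>j=1..k. (1 + complex_of_real (c j) * iexp t) / (1 + complex_of_real (c j)))"
    by (simp add: summand_gf_factorization prod_dividef c_def)
  also have "\<dots> = (\<Prod>j=1..k. 1 - complex_of_real (bernoulli_prob k j) + bernoulli_prob k j * iexp t)"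
  proof (intro prod.cong refl)
    fix j
    have "1 + complex_of_real (c j) \<noteq> 0"
      using pos[of j] by (metis less_irrefl of_real_1 of_real_add of_real_eq_0_iff)
    then show "(1 + complex_of_real (c j) * iexp t) / (1 + complex_of_real (c j)) =
        1 - complex_of_real (bernoulli_prob k j) + bernoulli_prob k j * iexp t"
      by (simp add: bernoulli_prob_def c_def[symmetric] divide_simps)
  qed
  finally show ?thesis .
qed

section \<open>The constants and the limit theorem\<close>

lemma delta_0: "delta 0 = sqrt ((1 + real m + real n)\<^sup>2 - 4 * real m * real n)"
  unfolding delta_def by (simp add: add_ac mult_ac)

lemma mean_const_eq: "mean_const n m = 1 - 1 / delta 0"
  using delta_gt_1[of 0] unfolding mean_const_def delta_0[symmetric] by (simp add: field_simps)

lemma var_const_eq: "var_const n m = eps 0 / delta 0 ^ 3"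
  unfolding var_const_def delta_0[symmetric] eps_def
  by (simp add: power2_eq_square algebra_simps)

lemma mean_const_pos: "0 < mean_const n m"
  unfolding mean_const_eq using delta_gt_1[of 0] by (simp add: field_simps)

lemma var_const_pos: "0 < var_const n m"
  unfolding var_const_eq using delta_gt_1[of 0] eps_pos[of 0] by simp

lemma mean_Y_asymp: "(\<lambda>k. mean_Y n m a k - mean_const n m * real k) \<in> O(\<lambda>k. 1)"
  unfolding mean_Y_eq mean_const_eq by (rule log_deriv_asymp)

lemma var_Y_asymp: "(\<lambda>k. var_Y n m a k - var_const n m * real k) \<in> O(\<lambda>k. 1)"
  unfolding var_Y_eq var_const_eq by (rule log_deriv2_asymp)

text \<open>A bounded error is negligible against \<open>k\<close>; this supplies the linear
  variance growth that \<open>bernoulli_sum_clt\<close> asks for.\<close>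

lemma var_Y_div: "(\<lambda>k. var_Y n m a k / real k) \<longlonglongrightarrow> var_const n m"
proof -
  have "(\<lambda>k. 1 :: real) \<in> o(\<lambda>k. real k)"
    by (rule smalloI_tendsto) (auto intro: lim_1_over_n eventually_gt_at_top[of 0, THEN eventually_mono])
  then have "(\<lambda>k. var_Y n m a k - var_const n m * real k) \<in> o(\<lambda>k. real k)"
    by (rule landau_o.big_small_trans[OF var_Y_asymp])
  then have "(\<lambda>k. (var_Y n m a k - var_const n m * real k) / real k) \<longlonglongrightarrow> 0"
    by (rule smalloD_tendsto)
  then have "(\<lambda>k. (var_Y n m a k - var_const n m * real k) / real k + var_const n m)
      \<longlonglongrightarrow> 0 + var_const n m"
    by (intro tendsto_intros)
  moreover have "eventually (\<lambda>k. (var_Y n m a k - var_const n m * real k) / real k + var_const n m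
      = var_Y n m a k / real k) sequentially"
    using eventually_gt_at_top[of 0] by eventually_elim (simp add: field_simps)
  ultimately show ?thesis by (simp add: tendsto_cong)
qed

lemma normalized_Y_clt:
  "weak_conv_m (\<lambda>k. distr (measure_pmf (uniform_below n m a k)) borel (normalized_Y n m a k))
     std_normal_distribution"
  unfolding normalized_Y_def[abs_def]
proof (rule bernoulli_sum_clt[where q = bernoulli_prob and c = "var_const n m"])
  show "0 \<le> bernoulli_prob k j \<and> bernoulli_prob k j \<le> 1" for k j
    using bernoulli_odds_nonneg[of k j] by (simp add: bernoulli_prob_def)
qed (rule char_Y mean_Y_bernoulli var_Y_bernoulli var_Y_div var_const_pos)+

end

theorem theorem1p2:
  fixes n m :: nat and a :: "nat \<Rightarrow> nat"
  assumes "0 < n" and "0 < m" and "is_bin_sequence n m a"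
  shows "0 < mean_const n m \<and> 0 < var_const n m \<and>
    (\<lambda>k. mean_Y n m a k - mean_const n m * real k) \<in> O(\<lambda>k. 1) \<and>
    (\<lambda>k. var_Y n m a k - var_const n m * real k) \<in> O(\<lambda>k. 1) \<and>
    weak_conv_m (\<lambda>k. distr (measure_pmf (uniform_below n m a k)) borel (normalized_Y n m a k))
      std_normal_distribution"
proof -
  interpret bin_sequence n m a by unfold_locales (fact assms)+
  show ?thesis
    using mean_const_pos var_const_pos mean_Y_asymp var_Y_asymp normalized_Y_clt by blast
qed

end
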